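(* Let $p$ be an odd prime, let $\lambda\in\{1,2,\ldots,p-1\}$, and for a sequence $S=x_1x_2\cdots x_m$ in $\mathbb{F}_p$ let $$\varphi(S)=\Big(\sum_{i=1}^m x_i\Big)^2+\lambda\sum_{i=1}^m x_i^2 .$$ Then $D(\varphi,p)=1$ if $\lambda=p-1$, and $2p-1\ge D(\varphi,p)\ge p-\lambda+1$ otherwise. In particular, for $p\ge 5$, letting $k$ be the smallest positive integer greater than $2$ such that $k\mid p-1$, we have: (a) if $\lambda=p-2$, then $3\le D(\varphi,p)\le \frac{k-1}{k}(p-1)+1$; (b) if $\lambda=p-3$, then $4\le D(\varphi,p)\le \frac{2k-2}{k}(p-1)+1$.
   Context: $\mathbb{F}_p$ is the field with $p$ elements. A sequence in $\mathbb{F}_p$ is a finite list of elements with repetition allowed, where the order is irrelevant (i.e. a finite multiset); its length is its number of terms counted with multiplicity, and a subsequence is a sub-multiset. $\varphi(S)$ is evaluated in $\mathbb{F}_p$, the integer $\lambda$ being reduced modulo $p$. A sequence $S$ is a $\varphi$-zero sequence if $\varphi(S)=0$ in $\mathbb{F}_p$. $D(\varphi,p)$ is the smallest positive integer $\ell$ such that every sequence in $\mathbb{F}_p$ of length at least $\ell$ has a nonempty $\varphi$-zero subsequence. *)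

theory Defs
  imports
    "HOL-Library.Multiset"
    "Berlekamp_Zassenhaus.Finite_Field"
begin

text \<open>
  The field with \<open>p\<close> elements is \<open>'p mod_ring\<close> for an index type \<open>'p\<close> of prime cardinality \<open>p\<close>.
  A sequence is a finite multiset, its length is \<^const>\<open>size\<close>, and subsequence is \<^term>\<open>(\<subseteq>#)\<close>.
\<close>

definition phi :: "nat \<Rightarrow> 'p::prime_card mod_ring multiset \<Rightarrow> 'p mod_ring" where
  "phi lam S = (\<Sum>x\<in>#S. x)\<^sup>2 + of_nat lam * (\<Sum>x\<in>#S. x\<^sup>2)"

definition zero_sequence ::
    "('p::prime_card mod_ring multiset \<Rightarrow> 'p mod_ring) \<Rightarrow> 'p mod_ring multiset \<Rightarrow> bool" where
  "zero_sequence f S \<longleftrightarrow> f S = 0"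

text \<open>
  The prime is implicit in the type of \<open>f\<close>. If no length works, the \<open>LEAST\<close> is an unspecified
  number, so an upper bound for it can only be derived by showing that some length does work.
\<close>

definition D :: "('p::prime_card mod_ring multiset \<Rightarrow> 'p mod_ring) \<Rightarrow> nat" where
  "D f = (LEAST l. l > 0 \<and>
     (\<forall>S. size S \<ge> l \<longrightarrow> (\<exists>T. T \<subseteq># S \<and> T \<noteq> {#} \<and> zero_sequence f T)))"

end

theory Submission
  imports Defs "Berlekamp_Zassenhaus.Berlekamp_Type_Based" "HOL-Number_Theory.Pocklington"
begin

text \<open>
  The bound \<open>2p - 1\<close> is a Chevalley-Warning argument over 0/1 vectors. If \<open>S\<close> has \<open>n\<close> terms, indexed by
  \<open>A\<close>, then \<open>\<phi>\<close> of the subsequence indexed by \<open>I \<subseteq> A\<close> is a polynomial of degree 2 in the indicator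
  variables of \<open>I\<close>, so \<open>1 - \<phi>\<^sup>p\<^sup>-\<^sup>1\<close> has degree at most \<open>2(p - 1)\<close>. For \<open>n > 2(p - 1)\<close> its alternating
  sum over all \<open>I\<close> vanishes; without a nonempty zero that sum would be 1, contributed by \<open>I = \<emptyset>\<close>.

  For the lower bound put \<open>l = p - \<lambda>\<close> and take the sequence of \<open>l - 1\<close> ones and one further term \<open>y\<close>.
  The value at \<open>m < l\<close> ones is \<open>m(m - l) \<noteq> 0\<close>, and the value at \<open>y\<close> and \<open>m\<close> ones is a quadratic in \<open>m\<close>
  whose discriminant is \<open>l((2y - 1)\<^sup>2 + l - 1)\<close>, so any \<open>y\<close> making this a nonsquare works.

  For \<open>\<lambda> = p - 1 - c\<close> a zero-free sequence contains no element \<open>c + 1\<close> times. If \<open>2 < k\<close> and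
  \<open>k dvd p - 1\<close>, it contains no full coset of the subgroup of order \<open>k\<close> either, because both the
  sum and the sum of squares over such a coset vanish. Hence each of the \<open>(p - 1)/k\<close> cosets
  contributes at most \<open>c(k - 1)\<close> terms.
\<close>

section \<open>Polynomial functions on subsets and their alternating sums\<close>

text \<open>
  Polynomial functions of degree at most \<open>d\<close> in the indicator variables of \<open>I\<close>: the monomial
  \<open>\<Prod>i\<in>J. x\<^sub>i\<close> takes the value 1 at \<open>I\<close> iff \<open>J \<subseteq> I\<close>.
\<close>
inductive subset_poly :: "nat \<Rightarrow> ('i set \<Rightarrow> 'a::comm_ring_1) \<Rightarrow> bool" where
  monomial: "finite J \<Longrightarrow> card J \<le> d \<Longrightarrow> subset_poly d (\<lambda>I. c * of_bool (J \<subseteq> I))"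
| add: "subset_poly d f \<Longrightarrow> subset_poly d g \<Longrightarrow> subset_poly d (\<lambda>I. f I + g I)"

lemma subset_poly_const: "subset_poly d (\<lambda>I. c)"
  using subset_poly.monomial[of "{}" d c] by simp

lemma subset_poly_sum:
  assumes "finite A" "\<And>x. x \<in> A \<Longrightarrow> subset_poly d (f x)"
  shows "subset_poly d (\<lambda>I. \<Sum>x\<in>A. f x I)"
  using assms
  by (induction A rule: finite_induct) (auto intro: subset_poly_const subset_poly.add)

text \<open>Indicator variables are idempotent, so the product of the monomials of \<open>J\<close>
  and \<open>K\<close> is the monomial of \<open>J \<union> K\<close>.\<close>

lemma subset_poly_mult:
  assumes "subset_poly d f" "subset_poly e g"
  shows "subset_poly (d + e) (\<lambda>I. f I * g I)"
  using assms(1)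
proof induction
  case (monomial J d c)
  from assms(2) show ?case
  proof induction
    case (monomial K e c')
    have "card (J \<union> K) \<le> d + e"
      using card_Un_le[of J K] monomial \<open>card J \<le> d\<close> by linarith
    then have "subset_poly (d + e) (\<lambda>I. (c * c') * of_bool (J \<union> K \<subseteq> I))"
      using monomial \<open>finite J\<close> by (intro subset_poly.monomial) auto
    moreover have "(\<lambda>I. (c * c') * of_bool (J \<union> K \<subseteq> I)) =
        (\<lambda>I. c * of_bool (J \<subseteq> I) * (c' * of_bool (K \<subseteq> I)))"
      by (auto simp: fun_eq_iff)
    ultimately show ?case by simp
  next
    case (add e g h)
    then show ?case by (simp add: ring_distribs subset_poly.add)
  qed
next
  case (add d f h)
  then show ?case by (simp add: ring_distribs subset_poly.add)
qed

lemma subset_poly_power: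
  "subset_poly d f \<Longrightarrow> subset_poly (d * n) (\<lambda>I. f I ^ n)"
proof (induction n)
  case (Suc n)
  then show ?case using subset_poly_mult[of d f "d * n" "\<lambda>I. f I ^ n"] by simp
qed (simp add: subset_poly_const)

lemma subset_poly_linear:
  fixes a :: "'i \<Rightarrow> 'a::comm_ring_1"
  assumes "finite A"
  shows "subset_poly 1 (\<lambda>I. \<Sum>i\<in>A. a i * of_bool (i \<in> I))"
proof (rule subset_poly_sum[OF assms])
  fix i
  show "subset_poly 1 (\<lambda>I. a i * of_bool (i \<in> I))"
    using subset_poly.monomial[of "{i}" 1 "a i"] by simp
qed

text \<open>Inserting or removing \<open>a\<close> pairs up the subsets of \<open>A\<close>. The two
  members of a pair have opposite signs and, since \<open>a \<notin> J\<close>, agree on whether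
  they contain \<open>J\<close>.\<close>

lemma alternating_sum_supersets:
  fixes c :: "'a::comm_ring_1"
  assumes "finite A" "a \<in> A" "a \<notin> J"
  shows "(\<Sum>I\<in>Pow A. (-1) ^ card I * (c * of_bool (J \<subseteq> I))) = 0"
proof -
  define B where "B = A - {a}"
  have B: "finite B" "A = insert a B" "a \<notin> B" using assms by (auto simp: B_def)
  have inj: "inj_on (insert a) (Pow B)" using B by (auto simp: inj_on_def)
  have disj: "Pow B \<inter> insert a ` Pow B = {}" using B by auto
  have "(\<Sum>I\<in>insert a ` Pow B. (-1) ^ card I * (c * of_bool (J \<subseteq> I))) =
      (\<Sum>I\<in>Pow B. (-1) ^ card (insert a I) * (c * of_bool (J \<subseteq> insert a I)))"
    using inj by (simp add: sum.reindex)
  also have "\<dots> = (\<Sum>I\<in>Pow B. - ((-1) ^ card I * (c * of_bool (J \<subseteq> I))))"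
  proof (rule sum.cong)
    fix I assume I: "I \<in> Pow B"
    then have "finite I" "a \<notin> I" using B by (auto intro: finite_subset)
    then have "card (insert a I) = Suc (card I)" by simp
    moreover have "J \<subseteq> insert a I \<longleftrightarrow> J \<subseteq> I" using assms(3) by auto
    ultimately show "(-1) ^ card (insert a I) * (c * of_bool (J \<subseteq> insert a I)) =
        - ((-1) ^ card I * (c * of_bool (J \<subseteq> I)))" by simp
  qed simp
  finally show ?thesis
    using B disj by (simp add: Pow_insert sum.union_disjoint sum_negf)
qed

text \<open>A monomial of degree below \<open>card A\<close> omits some element of \<open>A\<close>,
  so toggling that element cancels its sum; the rest is linearity.\<close>

lemma subset_poly_alternating_sum:
  assumes "subset_poly d f" "finite A" "d < card A"
  shows "(\<Sum>I\<in>Pow A. (-1) ^ card I * f I) = 0"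
  using assms(1,3)
proof induction
  case (monomial J d c)
  then have "\<not> A \<subseteq> J" using card_mono[of J A] by auto
  then show ?case using alternating_sum_supersets[OF assms(2)] by blast
next
  case (add d f g)
  then show ?case by (simp add: ring_distribs sum.distrib)
qed

section \<open>Chevalley-Warning over 0/1 vectors\<close>

lemma fermat_mod_ring:
  fixes x :: "'p::prime_card mod_ring"
  assumes "x \<noteq> 0"
  shows "x ^ (CARD('p) - 1) = 1"
proof -
  have "x * x ^ (CARD('p) - 1) = x * 1"
    using fermat_theorem_mod_ring[of x] by (simp flip: power_Suc)
  then show ?thesis using assms by (simp only: mult_cancel_left) simp
qed

lemma subset_poly_nonempty_zero:
  fixes f :: "'i set \<Rightarrow> 'p::prime_card mod_ring"
  assumes f: "subset_poly d f" "f {} = 0" and A: "finite A" "d * (CARD('p) - 1) < card A"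
  shows "\<exists>I\<subseteq>A. I \<noteq> {} \<and> f I = 0"
proof (rule ccontr)
  assume "\<not> ?thesis"
  then have nz: "f I \<noteq> 0" if "I \<subseteq> A" "I \<noteq> {}" for I using that by blast
  have "CARD('p) - 1 > 0" using prime_card[where 'a='p] prime_gt_1_nat by fastforce
  \<comment> \<open>By Fermat, \<open>g\<close> is the indicator function of the zeros of
    \<open>f\<close>. Subtraction is written as adding a multiple by \<open>-1\<close> to fit the
    closure rules of \<open>subset_poly\<close>.\<close>
  define g where "g = (\<lambda>I. 1 + (-1) * f I ^ (CARD('p) - 1))"
  have "subset_poly (d * (CARD('p) - 1)) g" unfolding g_def
    using subset_poly_mult[OF subset_poly_const[of 0 "-1"] subset_poly_power[OF f(1)]]
    by (intro subset_poly.add subset_poly_const) simp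
  then have "(\<Sum>I\<in>Pow A. (-1) ^ card I * g I) = 0"
    using A by (rule subset_poly_alternating_sum)
  moreover have "(\<Sum>I\<in>Pow A. (-1) ^ card I * g I) = (\<Sum>I\<in>{{}}. (-1) ^ card I * g I)"
  proof (rule sum.mono_neutral_right)
    show "\<forall>I\<in>Pow A - {{}}. (-1) ^ card I * g I = 0"
      using fermat_mod_ring[OF nz] by (simp add: g_def)
  qed (use A(1) in auto)
  moreover have "g {} = 1" using f(2) \<open>CARD('p) - 1 > 0\<close> by (simp add: g_def)
  ultimately show False by simp
qed

lemma phi_zero_subsequence:
  fixes S :: "'p::prime_card mod_ring multiset"
  assumes "size S \<ge> 2 * CARD('p) - 1"
  shows "\<exists>T. T \<subseteq># S \<and> T \<noteq> {#} \<and> phi lam T = 0"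
proof -
  obtain xs where xs: "mset xs = S" using ex_mset by blast
  \<comment> \<open>The variables are attached to positions, so that equal terms of \<open>S\<close>
    remain separately selectable.\<close>
  define A where "A = {..<length xs}"
  define f :: "nat set \<Rightarrow> 'p mod_ring" where "f = (\<lambda>I. (\<Sum>i\<in>A. xs ! i * of_bool (i \<in> I))\<^sup>2 +
     of_nat lam * (\<Sum>i\<in>A. (xs ! i)\<^sup>2 * of_bool (i \<in> I)))"
  have A: "finite A" by (simp add: A_def)
  have d: "subset_poly 2 f" unfolding f_def
  proof (rule subset_poly.add)
    show "subset_poly 2 (\<lambda>I. (\<Sum>i\<in>A. xs ! i * of_bool (i \<in> I))\<^sup>2)"
      using subset_poly_power[OF subset_poly_linear[OF A, of "nth xs"], of 2] by simp
    show "subset_poly 2 (\<lambda>I. of_nat lam * (\<Sum>i\<in>A. (xs ! i)\<^sup>2 * of_bool (i \<in> I)))"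
      \<comment> \<open>The constant is counted as having degree 1, which brings the total to 2 as
        for the square.\<close>
      using subset_poly_mult[OF subset_poly_const[of 1 "of_nat lam"]
          subset_poly_linear[OF A, of "\<lambda>i. (xs ! i)\<^sup>2"]]
      by (simp add: numeral_2_eq_2)
  qed
  have "CARD('p) > 1" using prime_card[where 'a='p] prime_gt_1_nat by blast
  moreover have "card A = size S" using xs by (auto simp: A_def)
  ultimately have "2 * (CARD('p) - 1) < card A" using assms by linarith
  moreover have "f {} = 0" by (simp add: f_def)
  ultimately obtain I where I: "I \<subseteq> A" "I \<noteq> {}" "f I = 0"
    using subset_poly_nonempty_zero[OF d _ A] by blast
  have fin: "finite I" using I A finite_subset by blast
  define T where "T = image_mset (nth xs) (mset_set I)"
  have "image_mset (nth xs) (mset_set A) = S"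
    using xs unfolding A_def
    by (metis atLeast0LessThan map_nth mset_map mset_upt)
  then have "T \<subseteq># S" unfolding T_def
    using I A by (metis image_mset_subseteq_mono subset_imp_msubset_mset_set)
  moreover have "T \<noteq> {#}" using I fin by (simp add: T_def mset_set_empty_iff)
  moreover have "phi lam T = f I"
  proof -
    have "(\<Sum>x\<in>#T. h x) = (\<Sum>i\<in>A. h (xs ! i) * of_bool (i \<in> I))" for h :: "'p mod_ring \<Rightarrow> 'p mod_ring"
    proof -
      have "(\<Sum>x\<in>#T. h x) = (\<Sum>i\<in>I. h (xs ! i))"
        by (simp add: T_def sum_unfold_sum_mset image_mset.compositionality comp_def)
      also have "\<dots> = (\<Sum>i\<in>A. h (xs ! i) * of_bool (i \<in> I))"
        using I A by (intro sum.mono_neutral_cong_left) auto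
      finally show ?thesis .
    qed
    from this[of "\<lambda>x. x"] this[of "\<lambda>x. x\<^sup>2"] show ?thesis by (simp add: phi_def f_def)
  qed
  ultimately show ?thesis using I by auto
qed

section \<open>Multiplicative cosets and the size of zero-free sequences\<close>

lemma primitive_root_mod_ring:
  obtains g :: "'p::prime_card mod_ring"
  where "\<And>i. g ^ i = 1 \<longleftrightarrow> CARD('p) - 1 dvd i" "bij_betw (\<lambda>i. g ^ i) {..<CARD('p) - 1} (- {0})"
proof -
  have p: "prime CARD('p)" by (rule prime_card)
  obtain a where a: "a \<in> totatives CARD('p)" "ord CARD('p) a = CARD('p) - 1"
    using residue_prime_has_primroot[OF p] by blast
  define g :: "'p mod_ring" where "g = of_nat a"
  have one: "g ^ i = 1 \<longleftrightarrow> CARD('p) - 1 dvd i" for i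
  proof -
    have "g ^ i = of_nat (a ^ i)" by (simp add: g_def)
    then have "g ^ i = 1 \<longleftrightarrow> of_nat (a ^ i) = (of_nat 1 :: 'p mod_ring)" by simp
    also have "\<dots> \<longleftrightarrow> [a ^ i = 1] (mod CARD('p))"
      by (simp only: of_nat_eq_iff_cong_CHAR semiring_char_mod_ring)
    also have "\<dots> \<longleftrightarrow> CARD('p) - 1 dvd i" using ord_divides[of a i "CARD('p)"] a by simp
    finally show ?thesis .
  qed
  have "CARD('p) - 1 > 0" using prime_gt_1_nat[OF p] by simp
  then have g0: "g \<noteq> 0" using one[of "CARD('p) - 1"] by (auto simp: zero_power)
  have inj: "inj_on (\<lambda>i. g ^ i) {..<CARD('p) - 1}"
  proof (rule linorder_inj_onI)
    fix i j assume ij: "i < j" "i \<in> {..<CARD('p) - 1}" "j \<in> {..<CARD('p) - 1}"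
    have "\<not> CARD('p) - 1 dvd j - i" using ij by (auto dest!: dvd_imp_le)
    then have "g ^ (j - i) \<noteq> 1" using one by blast
    moreover have "g ^ j = g ^ i * g ^ (j - i)" using ij by (simp flip: power_add)
    ultimately show "g ^ i \<noteq> g ^ j" using g0 by auto
  qed auto
  have "card ((\<lambda>i. g ^ i) ` {..<CARD('p) - 1}) = CARD('p) - 1" using card_image[OF inj] by simp
  also have "\<dots> = card (- {0 :: 'p mod_ring})" by (simp add: Compl_eq_Diff_UNIV card_Diff_subset)
  finally have "(\<lambda>i. g ^ i) ` {..<CARD('p) - 1} = - {0}"
    using g0 by (intro card_subset_eq) auto
  with inj one show ?thesis by (intro that[of g]) (auto simp: bij_betw_def)
qed

text \<open>The sum and the sum of squares are geometric, with ratios \<open>w\<close> and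
  \<open>w\<^sup>2\<close>. Both ratios differ from 1 and have \<open>k\<close>-th power 1, so both
  sums vanish, whatever \<open>lam\<close> is.\<close>

lemma phi_coset_zero:
  fixes w x :: "'p::prime_card mod_ring"
  assumes "w ^ k = 1" "w \<noteq> 1" "w\<^sup>2 \<noteq> 1"
  shows "phi lam (image_mset (\<lambda>i. x * w ^ i) (mset_set {..<k})) = 0"
proof -
  have "(\<Sum>i<k. x * w ^ i) = x * (\<Sum>i<k. w ^ i)" by (simp add: sum_distrib_left)
  also have "(\<Sum>i<k. w ^ i) = 0" using geometric_sum[OF assms(2), of k] assms(1) by simp
  finally have 1: "(\<Sum>i<k. x * w ^ i) = 0" by simp
  have "(\<Sum>i<k. (x * w ^ i)\<^sup>2) = x\<^sup>2 * (\<Sum>i<k. (w\<^sup>2) ^ i)"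
    by (simp add: sum_distrib_left power_mult_distrib flip: power_mult)
      (simp add: mult.commute)
  also have "(\<Sum>i<k. (w\<^sup>2) ^ i) = 0"
    using geometric_sum[OF assms(3), of k] assms(1) by (metis diff_self div_0 power_commuting_commutes power_mult power_one mult.commute)
  finally have 2: "(\<Sum>i<k. (x * w ^ i)\<^sup>2) = 0" by simp
  from 1 2 show ?thesis
    by (simp add: phi_def image_mset.compositionality comp_def flip: sum_unfold_sum_mset)
qed

text \<open>Applied to exponents of a primitive root \<open>g\<close>, the residue class of
  \<open>j\<close> modulo \<open>d\<close> becomes the coset of \<open>g ^ j\<close> under the
  powers of \<open>g ^ d\<close>.\<close>

lemma sum_residue_classes:
  fixes f :: "nat \<Rightarrow> 'a::comm_monoid_add"
  shows "(\<Sum>i<k * d. f i) = (\<Sum>j<d. \<Sum>i<k. f (j + d * i))"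
proof -
  have "(\<Sum>i<k * d. f i) = (\<Sum>i<k. \<Sum>j\<in>{i * d..<i * d + d}. f j)"
    by (rule sum.nat_group[symmetric])
  also have "\<dots> = (\<Sum>i<k. \<Sum>j<d. f (j + d * i))"
  proof (rule sum.cong)
    fix i
    have "(\<Sum>j\<in>{i * d..<i * d + d}. f j) = (\<Sum>j\<in>{0..<d}. f (j + i * d))"
      using sum.shift_bounds_nat_ivl[of f 0 "i * d" d] by (simp add: add.commute)
    then show "(\<Sum>j\<in>{i * d..<i * d + d}. f j) = (\<Sum>j<d. f (j + d * i))"
      by (simp add: lessThan_atLeast0 mult.commute)
  qed simp
  also have "\<dots> = (\<Sum>j<d. \<Sum>i<k. f (j + d * i))" by (rule sum.swap)
  finally show ?thesis .
qed

lemma zero_free_size_le: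
  fixes S :: "'p::prime_card mod_ring multiset"
  assumes free: "\<And>T. T \<subseteq># S \<Longrightarrow> T \<noteq> {#} \<Longrightarrow> phi lam T \<noteq> 0"
    and count: "\<And>x. x \<noteq> 0 \<Longrightarrow> count S x \<le> c"
    and k: "k > 2" "CARD('p) - 1 = k * d"
  shows "size S \<le> c * (k - 1) * d"
proof -
  obtain g :: "'p mod_ring" where
    one: "\<And>i. g ^ i = 1 \<longleftrightarrow> CARD('p) - 1 dvd i" and
    bij: "bij_betw (\<lambda>i. g ^ i) {..<CARD('p) - 1} (- {0})"
    using primitive_root_mod_ring by blast
  have "CARD('p) - 1 > 0" using prime_gt_1_nat[OF prime_card[where 'a='p]] by simp
  then have d: "d > 0" using k by (cases d) auto
  have g0: "g \<noteq> 0" using one[of "CARD('p) - 1"] \<open>CARD('p) - 1 > 0\<close> by (auto simp: zero_power)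
  define w where "w = g ^ d"
  \<comment> \<open>The order of \<open>w\<close> is \<open>k\<close>;
    \<open>w\<^sup>2 \<noteq> 1\<close> is where \<open>k > 2\<close> enters, as
    \<open>0 < 2 * d < k * d\<close>.\<close>
  have w: "w ^ k = 1" "w \<noteq> 1" "w\<^sup>2 \<noteq> 1"
    using k d by (auto simp: w_def one mult.commute simp flip: power_mult dest!: dvd_imp_le)
  have coset: "(\<Sum>i<k. count S (g ^ (j + d * i))) \<le> c * (k - 1)" if "j < d" for j
  proof -
    define T where "T = image_mset (\<lambda>i. g ^ j * w ^ i) (mset_set {..<k})"
    have "phi lam T = 0" unfolding T_def by (rule phi_coset_zero[OF w])
    moreover have "T \<noteq> {#}" using k by (auto simp: T_def mset_set_empty_iff)
    ultimately have "\<not> T \<subseteq># S" using free by blast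
    moreover have "T = mset_set ((\<lambda>i. g ^ (j + d * i)) ` {..<k})"
    proof -
      have "inj_on (\<lambda>i. g ^ (j + d * i)) {..<k}"
      proof (rule inj_onI)
        fix i i' assume i: "i \<in> {..<k}" "i' \<in> {..<k}" and eq: "g ^ (j + d * i) = g ^ (j + d * i')"
        have "j + d * i < CARD('p) - 1" if "i < k" for i
        proof -
          have "j + d * i < d * Suc i" using \<open>j < d\<close> by simp
          also have "\<dots> \<le> d * k" using that by (intro mult_le_mono2) simp
          finally show ?thesis using k by (simp add: mult.commute)
        qed
        with i eq have "j + d * i = j + d * i'"
          by (intro inj_onD[OF bij_betw_imp_inj_on[OF bij]]) auto
        then show "i = i'" using d by simp
      qed
      then show ?thesis
        by (simp add: T_def w_def image_mset_mset_set[symmetric] power_add power_mult)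
    qed
    \<comment> \<open>The coset \<open>T\<close> has no repeated terms, so it would be a subsequence
      as soon as all its elements occurred in \<open>S\<close>. Hence some element of the coset is
      absent, and \<open>k - 1\<close> remain.\<close>
    moreover have "mset_set X \<subseteq># S" if "X \<subseteq> set_mset S" for X
      using that by (intro mset_subset_eqI) (auto simp: count_mset_set' Suc_le_eq)
    ultimately have "\<not> (\<lambda>i. g ^ (j + d * i)) ` {..<k} \<subseteq> set_mset S" by blast
    then obtain i0 where i0: "i0 < k" "count S (g ^ (j + d * i0)) = 0"
      by (auto simp: count_eq_zero_iff)
    have "(\<Sum>i<k. count S (g ^ (j + d * i))) = (\<Sum>i\<in>{..<k} - {i0}. count S (g ^ (j + d * i)))"
      using i0 by (intro sum.mono_neutral_right) auto
    also have "\<dots> \<le> (\<Sum>i\<in>{..<k} - {i0}. c)" using g0 by (intro sum_mono count) simp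
    also have "\<dots> = c * (k - 1)" using i0 by simp
    finally show ?thesis .
  qed
  have "0 \<notin># S"
    using free[of "{#0#}"] by (auto simp: phi_def)
  then have "size S = (\<Sum>x\<in>- {0}. count S x)"
    unfolding size_multiset_overloaded_eq
    by (intro sum.mono_neutral_left) (auto simp: not_in_iff)
  also have "\<dots> = (\<Sum>i<CARD('p) - 1. count S (g ^ i))"
    using sum.reindex_bij_betw[OF bij] by metis
  also have "\<dots> = (\<Sum>j<d. \<Sum>i<k. count S (g ^ (j + d * i)))"
    unfolding k(2) by (rule sum_residue_classes)
  also have "\<dots> \<le> (\<Sum>j<d. c * (k - 1))" by (intro sum_mono coset) simp
  also have "\<dots> = c * (k - 1) * d" by simp
  finally show ?thesis .
qed

lemma phi_replicate:
  "phi lam (replicate_mset m x) = of_nat m * (of_nat m + of_nat lam) * x\<^sup>2"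
  by (simp add: phi_def algebra_simps power2_eq_square)

text \<open>By \<open>phi_replicate\<close>, \<open>Suc c\<close> copies of \<open>x\<close> have a
  value divisible by \<open>Suc c + lam\<close>, which is 0 in the field.\<close>

lemma count_le_if_zero_free:
  assumes "\<And>T. T \<subseteq># S \<Longrightarrow> T \<noteq> {#} \<Longrightarrow> phi lam T \<noteq> 0" and "of_nat (Suc c + lam) = (0 :: 'p::prime_card mod_ring)"
  shows "count S (x :: 'p mod_ring) \<le> c"
proof (rule ccontr)
  assume "\<not> ?thesis"
  then have "replicate_mset (Suc c) x \<subseteq># S" by (simp del: replicate_mset_Suc flip: count_le_replicate_mset_subset_eq)
  moreover have "phi lam (replicate_mset (Suc c) x) = 0"
    using assms(2) unfolding phi_replicate of_nat_add by simp
  ultimately show False using assms(1)[of "replicate_mset (Suc c) x"] by simp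
qed

section \<open>Nonsquares and a long zero-free sequence\<close>

lemma two_neq_zero_mod_ring:
  assumes "odd CARD('p::prime_card)"
  shows "(2 :: 'p::prime_card mod_ring) \<noteq> 0"
proof
  assume "(2 :: 'p mod_ring) = 0"
  then have "of_nat 2 = (0 :: 'p mod_ring)" by simp
  then have "CARD('p) dvd 2" by (rule of_nat_0_mod_ring_dvd)
  then have "CARD('p) \<le> 2" by (simp add: dvd_imp_le)
  then have "CARD('p) = 2" using prime_ge_2_nat[OF prime_card[where 'a='p]] by simp
  with assms show False by simp
qed

text \<open>Squaring identifies 1 and -1, so on a finite field of odd order it is not injective,
  hence not surjective.\<close>

lemma exists_nonsquare:
  assumes "odd CARD('p::prime_card)"
  shows "\<exists>x :: 'p mod_ring. \<forall>s. x \<noteq> s\<^sup>2"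
proof (rule ccontr)
  assume "\<not> ?thesis"
  then have "surj (\<lambda>s :: 'p mod_ring. s\<^sup>2)" by (metis surjI)
  then have "inj (\<lambda>s :: 'p mod_ring. s\<^sup>2)" by (simp add: finite_UNIV_surj_inj)
  then have "(1 :: 'p mod_ring) = -1" by (rule injD) simp
  then have "(2 :: 'p mod_ring) = 0" by (metis add.right_inverse one_add_one)
  with two_neq_zero_mod_ring[OF assms] show False by blast
qed

text \<open>Provides the nonsquare discriminant for the lower bound. For \<open>l = 1\<close> the
  expression would be the square \<open>t\<^sup>2\<close>.\<close>

lemma exists_nonsquare_value:
  fixes l :: "'p::prime_card mod_ring"
  assumes "odd CARD('p)" "l \<noteq> 0" "l \<noteq> 1"
  shows "\<exists>t. \<forall>s. l * (t\<^sup>2 + l - 1) \<noteq> s\<^sup>2"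
proof (cases "\<exists>r. l = r\<^sup>2")
  case True
  then obtain r where r: "l = r\<^sup>2" ..
  with assms have r0: "r \<noteq> 0" by auto
  \<comment> \<open>Otherwise the squares are closed under adding \<open>l - 1\<close>, hence exhaust the field.\<close>
  show ?thesis
  proof (rule ccontr)
    assume "\<not> ?thesis"
    then have sq: "\<exists>s. l * (t\<^sup>2 + l - 1) = s\<^sup>2" for t by blast
    have step: "\<exists>s. t\<^sup>2 + (l - 1) = s\<^sup>2" for t
    proof -
      obtain s where "r\<^sup>2 * (t\<^sup>2 + l - 1) = s\<^sup>2" using sq r by metis
      then have "t\<^sup>2 + (l - 1) = (s / r)\<^sup>2"
        using r0 by (simp add: field_simps)
      then show ?thesis ..
    qed
    have all: "\<exists>s. of_nat n * (l - 1) = s\<^sup>2" for n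
    proof (induction n)
      case 0
      show ?case by (rule exI[of _ 0]) simp
    next
      case (Suc n)
      then obtain t where "of_nat n * (l - 1) = t\<^sup>2" by blast
      then show ?case using step[of t] by (simp add: algebra_simps)
    qed
    obtain x :: "'p mod_ring" where x: "\<And>s. x \<noteq> s\<^sup>2" using exists_nonsquare[OF assms(1)] by blast
    obtain n where "x / (l - 1) = of_nat n" using surj_of_nat_mod_ring by blast
    then have "of_nat n * (l - 1) = x" using assms(3) by (simp add: field_simps)
    with all x show False by metis
  qed
next
  case False
  have two: "(2 :: 'p mod_ring) \<noteq> 0" by (rule two_neq_zero_mod_ring[OF assms(1)])
  from no_zero_divisors[OF two two] have four: "(4 :: 'p mod_ring) \<noteq> 0" by simp
  \<comment> \<open>Chosen such that \<open>t\<^sup>2 + l - 1 = (l / 2)\<^sup>2\<close>.\<close>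
  define t where "t = (l - 2) / 2"
  have "l * (t\<^sup>2 + l - 1) = l * (l / 2)\<^sup>2"
    using two four by (simp add: t_def field_simps power2_eq_square)
  moreover have "l * (l / 2)\<^sup>2 \<noteq> s\<^sup>2" for s
  proof
    assume "l * (l / 2)\<^sup>2 = s\<^sup>2"
    then have "l = (s / (l / 2))\<^sup>2" using assms(2) two four by (simp add: power_divide field_simps)
    with False show False by blast
  qed
  ultimately show ?thesis by metis
qed

lemma zero_free_sequence:
  assumes "odd CARD('p::prime_card)" "1 \<le> lam" "lam < CARD('p) - 1"
  obtains S :: "'p::prime_card mod_ring multiset" where "size S = CARD('p) - lam"
    and "\<And>T. T \<subseteq># S \<Longrightarrow> T \<noteq> {#} \<Longrightarrow> phi lam T \<noteq> 0"
proof -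
  define l where "l = CARD('p) - lam"
  have l: "l > 1" "l < CARD('p)" using assms by (auto simp: l_def)
  have of_nat_nz: "of_nat n \<noteq> (0 :: 'p mod_ring)" if "0 < n" "n < CARD('p)" for n
    using that of_nat_0_mod_ring_dvd[of n, where 'a='p] nat_dvd_not_less by blast
  have "of_nat l + of_nat lam = (of_nat CARD('p) :: 'p mod_ring)"
    unfolding of_nat_add[symmetric] using assms by (simp add: l_def)
  then have lam: "of_nat lam = (- of_nat l :: 'p mod_ring)"
    by (simp add: eq_neg_iff_add_eq_0 add.commute)
  have "of_nat l \<noteq> (0 :: 'p mod_ring)" using of_nat_nz l by simp
  moreover have "of_nat l \<noteq> (1 :: 'p mod_ring)"
    using of_nat_nz[of "l - 1"] l by (simp add: of_nat_diff)
  ultimately obtain t :: "'p mod_ring" where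
    t: "\<And>s. of_nat l * (t\<^sup>2 + of_nat l - 1) \<noteq> s\<^sup>2"
    using exists_nonsquare_value[OF assms(1)] by blast
  have two: "(2 :: 'p mod_ring) \<noteq> 0" using of_nat_nz[of 2] l by simp
  \<comment> \<open>Solves \<open>t = 2 * y - 1\<close>, the form in which \<open>y\<close> enters
    the discriminant.\<close>
  define y where "y = (t + 1) / 2"
  have y: "t = 2 * y - 1" using two by (simp add: y_def)
  define S where "S = add_mset y (replicate_mset (l - 1) 1)"
  show ?thesis
  proof (rule that[of S])
    show "size S = CARD('p) - lam" using l by (simp add: S_def l_def)
    fix T assume T: "T \<subseteq># S" "T \<noteq> {#}"
    show "phi lam T \<noteq> 0"
    proof (cases "T \<subseteq># replicate_mset (l - 1) 1")
      case True
      then obtain m where m: "T = replicate_mset m 1" "m \<le> l - 1"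
        by (metis msubseteq_replicate_msetE size_replicate_mset size_mset_mono)
      with T have "0 < m" by (cases m) auto
      have "of_nat m \<noteq> (0 :: 'p mod_ring)" using of_nat_nz m l \<open>0 < m\<close> by simp
      moreover have "of_nat m - of_nat l \<noteq> (0 :: 'p mod_ring)"
      proof -
        have "m < l" using m l by linarith
        then have "of_nat l - of_nat m \<noteq> (0 :: 'p mod_ring)"
          using of_nat_nz[of "l - m"] l by (simp add: of_nat_diff)
        then show ?thesis by simp
      qed
      ultimately show ?thesis unfolding m(1) phi_replicate lam by simp
    next
      case False
      have "y \<in># T"
      proof (rule ccontr)
        assume "y \<notin># T"
        then have "T \<subseteq># replicate_mset (l - 1) 1"
          using T(1) unfolding S_def by (metis diff_single_trivial subset_eq_diff_conv add_mset_add_single)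
        with False show False by simp
      qed
      then obtain R where R: "T = add_mset y R" by (metis insert_DiffM)
      with T have "R \<subseteq># replicate_mset (l - 1) 1" by (simp add: S_def)
      then obtain m where m: "R = replicate_mset m 1" by (metis msubseteq_replicate_msetE)
      have "phi lam T = (y + of_nat m)\<^sup>2 - of_nat l * (y\<^sup>2 + of_nat m)"
        by (simp add: phi_def R m lam)
      \<comment> \<open>Completing the square in \<open>m\<close>: the discriminant is a square
        minus \<open>4 * phi lam T\<close>, so \<open>phi lam T = 0\<close> would make it a
        square.\<close>
      moreover have "of_nat l * (t\<^sup>2 + of_nat l - 1) = (2 * of_nat m + 2 * y - of_nat l)\<^sup>2
          - 4 * ((y + of_nat m)\<^sup>2 - of_nat l * (y\<^sup>2 + of_nat m))"
        unfolding y by (simp add: algebra_simps power2_eq_square)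
      ultimately show ?thesis using t by (metis diff_zero mult_zero_right)
    qed
  qed
qed

section \<open>Bounds for the constant \<open>D\<close>\<close>

lemma D_eq_Least:
  "D (phi lam :: 'p::prime_card mod_ring multiset \<Rightarrow> _) = (LEAST l. l > 0 \<and>
     (\<forall>S :: 'p mod_ring multiset. size S \<ge> l \<longrightarrow> (\<exists>T. T \<subseteq># S \<and> T \<noteq> {#} \<and> phi lam T = 0)))"
  by (simp add: D_def zero_sequence_def)

lemma D_le:
  fixes lam :: nat
  assumes "l > 0" "\<And>S :: 'p::prime_card mod_ring multiset. size S \<ge> l \<Longrightarrow>
    \<exists>T. T \<subseteq># S \<and> T \<noteq> {#} \<and> phi lam T = 0"
  shows "D (phi lam :: 'p mod_ring multiset \<Rightarrow> _) \<le> l"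
  unfolding D_eq_Least by (rule Least_le) (use assms in blast)

lemma D_le_2p:
  "D (phi lam :: 'p::prime_card mod_ring multiset \<Rightarrow> _) \<le> 2 * CARD('p) - 1"
  using prime_gt_1_nat[OF prime_card[where 'a='p]]
  by (intro D_le phi_zero_subsequence) auto

text \<open>The length \<open>2p - 1\<close> works, so the \<open>LEAST\<close> is attained and has
  the defining property itself.\<close>

lemma D_spec:
  fixes S :: "'p::prime_card mod_ring multiset"
  shows "D (phi lam :: 'p mod_ring multiset \<Rightarrow> _) > 0"
    and "size S \<ge> D (phi lam :: 'p mod_ring multiset \<Rightarrow> _) \<Longrightarrow>
      \<exists>T. T \<subseteq># S \<and> T \<noteq> {#} \<and> phi lam T = 0"
proof -
  let ?P = "\<lambda>l. l > 0 \<and> (\<forall>S :: 'p mod_ring multiset. size S \<ge> l \<longrightarrow>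
    (\<exists>T. T \<subseteq># S \<and> T \<noteq> {#} \<and> phi lam T = 0))"
  have "2 * CARD('p) - 1 > 0" using prime_gt_1_nat[OF prime_card[where 'a='p]] by auto
  then have "?P (2 * CARD('p) - 1)" using phi_zero_subsequence[where 'p='p] by blast
  then have "?P (LEAST l. ?P l)" by (rule LeastI)
  then show "D (phi lam :: 'p mod_ring multiset \<Rightarrow> _) > 0"
    and "size S \<ge> D (phi lam :: 'p mod_ring multiset \<Rightarrow> _) \<Longrightarrow>
      \<exists>T. T \<subseteq># S \<and> T \<noteq> {#} \<and> phi lam T = 0"
    unfolding D_eq_Least by blast+
qed

lemma D_ge:
  assumes "odd CARD('p::prime_card)" "1 \<le> lam" "lam < CARD('p) - 1"
  shows "CARD('p) - lam + 1 \<le> D (phi lam :: 'p mod_ring multiset \<Rightarrow> _)"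
proof (rule ccontr)
  assume *: "\<not> ?thesis"
  obtain S :: "'p mod_ring multiset" where S: "size S = CARD('p) - lam"
    "\<And>T. T \<subseteq># S \<Longrightarrow> T \<noteq> {#} \<Longrightarrow> phi lam T \<noteq> 0"
    using zero_free_sequence[OF assms] by blast
  with * have "size S \<ge> D (phi lam :: 'p mod_ring multiset \<Rightarrow> _)" by simp
  then show False using D_spec(2) S(2) by blast
qed

text \<open>Covers (a) with \<open>c = 1\<close> and (b) with \<open>c = 2\<close>; the first
  assumption expresses \<open>lam = p - 1 - c\<close> as a congruence.\<close>

lemma D_le_count:
  assumes "of_nat (Suc c + lam) = (0 :: 'p::prime_card mod_ring)" "k > 2" "k dvd CARD('p) - 1"
  shows "real (D (phi lam :: 'p mod_ring multiset \<Rightarrow> _))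
    \<le> real c * (real k - 1) / real k * (real CARD('p) - 1) + 1"
proof -
  obtain d where d: "CARD('p) - 1 = k * d" using assms(3) by blast
  have "D (phi lam :: 'p mod_ring multiset \<Rightarrow> _) \<le> c * (k - 1) * d + 1"
  proof (rule D_le)
    fix S :: "'p mod_ring multiset"
    assume size: "c * (k - 1) * d + 1 \<le> size S"
    show "\<exists>T. T \<subseteq># S \<and> T \<noteq> {#} \<and> phi lam T = 0"
    proof (rule ccontr)
      assume "\<not> ?thesis"
      then have free: "phi lam T \<noteq> 0" if "T \<subseteq># S" "T \<noteq> {#}" for T using that by blast
      have "size S \<le> c * (k - 1) * d"
        using free count_le_if_zero_free[OF free assms(1)] assms(2) d
        by (rule zero_free_size_le)
      with size show False by simp
    qed
  qed simp
  then have "real (D (phi lam :: 'p mod_ring multiset \<Rightarrow> _)) \<le> real (c * (k - 1) * d + 1)"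
    by (rule of_nat_mono)
  also have "\<dots> = real c * (real k - 1) * real d + 1" using assms(2) by (simp add: of_nat_diff)
  also have "real d = (real CARD('p) - 1) / real k"
  proof -
    have "real (CARD('p) - 1) = real k * real d" unfolding d by simp
    moreover have "real (CARD('p) - 1) = real CARD('p) - 1"
      using prime_gt_1_nat[OF prime_card[where 'a='p]] by (simp add: of_nat_diff)
    ultimately show ?thesis using assms(2) by (simp add: field_simps)
  qed
  finally show ?thesis by simp
qed

text \<open>Every single term \<open>x\<close> is already a zero subsequence, with value
  \<open>(1 + lam) * x\<^sup>2 = 0\<close>.\<close>

lemma D_eq_1:
  assumes "of_nat (Suc lam) = (0 :: 'p::prime_card mod_ring)"
  shows "D (phi lam :: 'p mod_ring multiset \<Rightarrow> _) = 1"
proof (rule antisym)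
  show "D (phi lam :: 'p mod_ring multiset \<Rightarrow> _) \<le> 1"
  proof (rule D_le)
    fix S :: "'p mod_ring multiset"
    assume "1 \<le> size S"
    then obtain x where x: "x \<in># S" by (metis multiset_nonemptyE not_one_le_zero size_empty)
    have "phi lam {#x#} = 0" using phi_replicate[of lam 1 x] assms by simp
    with x show "\<exists>T. T \<subseteq># S \<and> T \<noteq> {#} \<and> phi lam T = 0" by (intro exI[of _ "{#x#}"]) simp
  qed simp
  show "1 \<le> D (phi lam :: 'p mod_ring multiset \<Rightarrow> _)"
    using D_spec(1)[where 'p='p, of lam] by simp
qed

theorem theorem3p1:
  fixes p lam :: nat
    and \<phi> :: "'p::prime_card mod_ring multiset \<Rightarrow> 'p mod_ring"
  assumes "p = CARD('p)" and "prime p" and "odd p"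
    and "lam \<in> {1..p - 1}"
    and "\<phi> = phi lam"
  shows "(lam = p - 1 \<longrightarrow> D \<phi> = 1) \<and>
    (lam \<noteq> p - 1 \<longrightarrow> p - lam + 1 \<le> D \<phi> \<and> D \<phi> \<le> 2 * p - 1) \<and>
    (p \<ge> 5 \<longrightarrow>
      (let k = (LEAST k::nat. k > 2 \<and> k dvd p - 1) in
        (lam = p - 2 \<longrightarrow>
           3 \<le> D \<phi> \<and> real (D \<phi>) \<le> (real k - 1) / real k * (real p - 1) + 1) \<and>
        (lam = p - 3 \<longrightarrow>
           4 \<le> D \<phi> \<and> real (D \<phi>) \<le> (2 * real k - 2) / real k * (real p - 1) + 1)))"
proof -
  note p = assms(1)[symmetric]
  have lam: "1 \<le> lam" "lam \<le> p - 1" using assms(4) by auto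
  have "p > 2" using prime_ge_2_nat[OF assms(2)] assms(3) by (cases "p = 2") auto
  have odd: "odd CARD('p)" using assms(1,3) by simp
  have zero: "of_nat (n + lam) = (0 :: 'p mod_ring)" if "n + lam = p" for n
    using that of_nat_card_eq_0[where 'a='p] p by simp
  have one: "D \<phi> = 1" if "lam = p - 1"
    unfolding assms(5) using zero[of 1] that \<open>p > 2\<close> by (intro D_eq_1) simp
  have lower: "p - lam + 1 \<le> D \<phi>" if "lam \<noteq> p - 1"
    unfolding assms(5) using D_ge[OF odd lam(1)] that lam p by simp
  have upper: "D \<phi> \<le> 2 * p - 1" unfolding assms(5) using D_le_2p[where 'p='p] p by simp
  define k where "k = (LEAST k::nat. k > 2 \<and> k dvd p - 1)"
  have special: "(lam = p - 2 \<longrightarrow>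
           3 \<le> D \<phi> \<and> real (D \<phi>) \<le> (real k - 1) / real k * (real p - 1) + 1) \<and>
        (lam = p - 3 \<longrightarrow>
           4 \<le> D \<phi> \<and> real (D \<phi>) \<le> (2 * real k - 2) / real k * (real p - 1) + 1)" if "p \<ge> 5"
  proof -
    \<comment> \<open>\<open>p - 1\<close> itself is a candidate for \<open>k\<close>, so the
      \<open>LEAST\<close> is attained.\<close>
    have "p - 1 > 2 \<and> p - 1 dvd p - 1" using that by simp
    then have "k > 2 \<and> k dvd p - 1" unfolding k_def by (rule LeastI)
    then have k: "k > 2" "k dvd CARD('p) - 1" using p by auto
    have bound: "real (D \<phi>) \<le> real c * (real k - 1) / real k * (real p - 1) + 1"
      if "Suc c + lam = p" for c
      using D_le_count[OF zero[OF that] k] unfolding assms(5) p .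
    show ?thesis
    \<comment> \<open>For \<open>lam = p - 1 - c\<close> the general lower bound reads
      \<open>c + 2\<close>, giving 3 and 4.\<close>
    proof (intro conjI impI)
      assume "lam = p - 2"
      with bound[of 1] lower that show "3 \<le> D \<phi>"
        and "real (D \<phi>) \<le> (real k - 1) / real k * (real p - 1) + 1" by auto
    next
      assume "lam = p - 3"
      with bound[of 2] lower that show "4 \<le> D \<phi>"
        and "real (D \<phi>) \<le> (2 * real k - 2) / real k * (real p - 1) + 1"
        by (auto simp: algebra_simps)
    qed
  qed
  show ?thesis
    using one lower upper special unfolding k_def Let_def by blast
qed

end
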